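(* Let $G$ be the graph with vertex set $\{a_i,b_i,c_i : i\in[4]\}\cup\{q_i^j,r_i^j : i\in[4], j\in[2]\}$ (28 vertices) and the following edges, where indices of $a,b,c$ are taken so that $i\bmod 4+1$ follows $i$: the three four-cycles $a_ia_{i\bmod 4+1}$, $b_ib_{i\bmod 4+1}$, $c_ic_{i\bmod 4+1}$ for $i\in[4]$; the edges $q_i^j a_k, q_i^j b_k, q_i^j c_k$ for all $i,k\in[4]$, $j\in[2]$; the edges $r_i^jq_i^j$ for $i\in[4],j\in[2]$; and the edges $r_i^ja_i, r_i^ja_{i\bmod 4+1}, r_i^jb_i, r_i^jb_{i\bmod 4+1}, r_i^jc_i, r_i^jc_{i\bmod 4+1}$ for $i\in[4],j\in[2]$. Then $G$ does not admit a planar geometric storyplan.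
   Context: A storyplan of a graph $G$ on time steps $[\ell]=\{1,\dots,\ell\}$ is a pair $(A,\mathcal{D})$ where: $A$ assigns to each vertex $v$ a nonempty interval $A(v)=[s_v,e_v]\subseteq[\ell]$ of consecutive integers (the visible interval; $v$ is visible at each $t\in A(v)$); for every edge $uv$ we have $A(u)\cap A(v)\neq\emptyset$; and $\mathcal{D}$ assigns one fixed point to each vertex and one fixed curve to each edge. For $t\in[\ell]$, the frame at $t$ is the drawing under $\mathcal{D}$ of the induced subgraph $G[\{v : t\in A(v)\}]$. A storyplan is planar geometric if every frame is a planar drawing in which every edge is a straight-line segment. *)

theory Defs
  imports "HOL-Analysis.Analysis"
begin

text \<open>General notions. A graph is given by a vertex set V and an edge set E of
  unordered pairs (two-element sets) of vertices. A storyplan on time steps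
  {1..l} assigns each vertex v the visible interval {s v..e v}; the drawing
  assigns each vertex a point p v in the plane. In a planar geometric storyplan every
  edge is drawn as the straight-line segment between its endpoints, so the
  drawing is determined by p.\<close>

definition storyplan_intervals ::
  "'v set \<Rightarrow> 'v set set \<Rightarrow> nat \<Rightarrow> ('v \<Rightarrow> nat) \<Rightarrow> ('v \<Rightarrow> nat) \<Rightarrow> bool" where
  "storyplan_intervals V E l s e \<longleftrightarrow>
     (\<forall>v\<in>V. 1 \<le> s v \<and> s v \<le> e v \<and> e v \<le> l) \<and>
     (\<forall>u\<in>V. \<forall>v\<in>V. {u, v} \<in> E \<longrightarrow> {s u..e u} \<inter> {s v..e v} \<noteq> {})"

definition planar_straight_line_drawing ::
  "'v set \<Rightarrow> 'v set set \<Rightarrow> ('v \<Rightarrow> real \<times> real) \<Rightarrow> 'v set \<Rightarrow> bool" where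
  "planar_straight_line_drawing V E p S \<longleftrightarrow>
     inj_on p S \<and>
     (\<forall>u\<in>S. \<forall>v\<in>S. \<forall>w\<in>S. {u, v} \<in> E \<longrightarrow> w \<notin> {u, v} \<longrightarrow>
         p w \<notin> closed_segment (p u) (p v)) \<and>
     (\<forall>u\<in>S. \<forall>v\<in>S. \<forall>x\<in>S. \<forall>y\<in>S. {u, v} \<in> E \<longrightarrow> {x, y} \<in> E \<longrightarrow> {u, v} \<noteq> {x, y} \<longrightarrow>
         closed_segment (p u) (p v) \<inter> closed_segment (p x) (p y) \<subseteq> p ` ({u, v} \<inter> {x, y}))"

definition visible_at :: "'v set \<Rightarrow> ('v \<Rightarrow> nat) \<Rightarrow> ('v \<Rightarrow> nat) \<Rightarrow> nat \<Rightarrow> 'v set" where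
  "visible_at V s e t = {v \<in> V. s v \<le> t \<and> t \<le> e v}"

definition planar_geometric_storyplan ::
  "'v set \<Rightarrow> 'v set set \<Rightarrow> nat \<Rightarrow> ('v \<Rightarrow> nat) \<Rightarrow> ('v \<Rightarrow> nat) \<Rightarrow> ('v \<Rightarrow> real \<times> real) \<Rightarrow> bool" where
  "planar_geometric_storyplan V E l s e p \<longleftrightarrow>
     storyplan_intervals V E l s e \<and>
     (\<forall>t\<in>{1..l}. planar_straight_line_drawing V E p (visible_at V s e t))"

definition admits_planar_geometric_storyplan :: "'v set \<Rightarrow> 'v set set \<Rightarrow> bool" where
  "admits_planar_geometric_storyplan V E \<longleftrightarrow>
     (\<exists>l s e p. planar_geometric_storyplan V E l s e p)"

datatype gv = A nat | B nat | C nat | Q nat nat | R nat nat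

definition nxt :: "nat \<Rightarrow> nat" where "nxt i = i mod 4 + 1"

definition G_V :: "gv set" where
  "G_V = {A i | i. i \<in> {1..4}} \<union> {B i | i. i \<in> {1..4}} \<union> {C i | i. i \<in> {1..4}}
       \<union> {Q i j | i j. i \<in> {1..4} \<and> j \<in> {1..2}} \<union> {R i j | i j. i \<in> {1..4} \<and> j \<in> {1..2}}"

definition G_E :: "gv set set" where
  "G_E =
     {{A i, A (nxt i)} | i. i \<in> {1..4}} \<union>
     {{B i, B (nxt i)} | i. i \<in> {1..4}} \<union>
     {{C i, C (nxt i)} | i. i \<in> {1..4}} \<union>
     {{Q i j, A k} | i j k. i \<in> {1..4} \<and> j \<in> {1..2} \<and> k \<in> {1..4}} \<union>
     {{Q i j, B k} | i j k. i \<in> {1..4} \<and> j \<in> {1..2} \<and> k \<in> {1..4}} \<union>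
     {{Q i j, C k} | i j k. i \<in> {1..4} \<and> j \<in> {1..2} \<and> k \<in> {1..4}} \<union>
     {{R i j, Q i j} | i j. i \<in> {1..4} \<and> j \<in> {1..2}} \<union>
     {{R i j, A i} | i j. i \<in> {1..4} \<and> j \<in> {1..2}} \<union>
     {{R i j, A (nxt i)} | i j. i \<in> {1..4} \<and> j \<in> {1..2}} \<union>
     {{R i j, B i} | i j. i \<in> {1..4} \<and> j \<in> {1..2}} \<union>
     {{R i j, B (nxt i)} | i j. i \<in> {1..4} \<and> j \<in> {1..2}} \<union>
     {{R i j, C i} | i j. i \<in> {1..4} \<and> j \<in> {1..2}} \<union>
     {{R i j, C (nxt i)} | i j. i \<in> {1..4} \<and> j \<in> {1..2}}"

end

theory Submission
  imports Defs
begin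

text \<open>Call the \<open>Q i j\<close> hubs and the twelve vertices \<open>A i\<close>, \<open>B i\<close>, \<open>C i\<close> cycle vertices.
  If some two cycle vertices were never visible together, all hubs would pairwise meet; as the
  intervals of a 4-cycle have a chord, Helly's theorem on the line would then show three cycle
  vertices and all hubs in one frame, which contains a \<open>K\<^bsub>3,3\<^esub>\<close>. So all cycle vertices
  share a common time. A frame with all cycle vertices cannot hold two hubs: they would have
  to be on different sides of each of the three cycles, but a hub is inside at most one of them. So the hubs have pairwise disjoint intervals, and
  at most one \<open>R i j\<close> vanishes too early and at most one appears too late to be seen in a frame
  with its hub and all cycle vertices. Hence two frames show all cycle vertices together with
  \<open>Q i j\<close> and \<open>R i j\<close> for two opposite values of \<open>i\<close>. In each of them at least two of the three
  cycles lie in the triangle spanned by the hub and the \<open>i\<close>-th cycle edge. A cycle for which this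
  happens in both frames has its two other edges converging on both sides, which is absurd.\<close>

section \<open>Orientations in the plane\<close>

text \<open>Twice the signed area of the triangle, positive for a counterclockwise turn.\<close>

definition orient :: "real \<times> real \<Rightarrow> real \<times> real \<Rightarrow> real \<times> real \<Rightarrow> real" where
  "orient a b c = (fst b - fst a) * (snd c - snd a) - (snd b - snd a) * (fst c - fst a)"

text \<open>Cramer's rule in the affine frame with origin \<open>a\<close> and axes
  \<open>b - a\<close>, \<open>c - a\<close>.\<close>

lemma orient_cramer:
  assumes "orient a b c \<noteq> 0"
  shows "x = a + (orient a x c / orient a b c) *\<^sub>R (b - a) + (orient a b x / orient a b c) *\<^sub>R (c - a)"
proof -
  have "orient a b c *\<^sub>R (x - a) = orient a x c *\<^sub>R (b - a) + orient a b x *\<^sub>R (c - a)"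
    by (simp add: orient_def prod_eq_iff algebra_simps)
  then have "x - a = (1 / orient a b c) *\<^sub>R (orient a x c *\<^sub>R (b - a) + orient a b x *\<^sub>R (c - a))"
    using assms by (metis divide_self_if mult.commute real_vector.scale_one scaleR_scaleR times_divide_eq_left mult_1)
  then have "x - a = (orient a x c / orient a b c) *\<^sub>R (b - a) + (orient a b x / orient a b c) *\<^sub>R (c - a)"
    by (simp add: scaleR_add_right)
  then show ?thesis by (simp add: algebra_simps)
qed

lemma orient_0_imp_collinear:
  assumes "orient a b c = 0"
  shows "collinear {a, b, c}"
proof (cases "a = b")
  case False
  then have "fst b - fst a \<noteq> 0 \<or> snd b - snd a \<noteq> 0" by (auto simp: prod_eq_iff)
  then have "\<exists>t. c = a + t *\<^sub>R (b - a)"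
  proof
    assume d: "fst b - fst a \<noteq> 0"
    have "snd c - snd a = (fst c - fst a) * (snd b - snd a) / (fst b - fst a)"
      using assms d by (subst nonzero_eq_divide_eq) (auto simp: orient_def algebra_simps)
    with d show ?thesis
      by (intro exI[of _ "(fst c - fst a) / (fst b - fst a)"]) (simp add: prod_eq_iff)
  next
    assume d: "snd b - snd a \<noteq> 0"
    have "fst c - fst a = (snd c - snd a) * (fst b - fst a) / (snd b - snd a)"
      using assms d by (subst nonzero_eq_divide_eq) (auto simp: orient_def algebra_simps)
    with d show ?thesis
      by (intro exI[of _ "(snd c - snd a) / (snd b - snd a)"]) (simp add: prod_eq_iff)
  qed
  then obtain t where "c = a + t *\<^sub>R (b - a)" ..
  then have "\<forall>x\<in>{a,b,c}. \<exists>k. x = a + k *\<^sub>R (b - a)"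
    by (auto intro: exI[of _ 0] exI[of _ 1])
  then show ?thesis unfolding collinear_alt by blast
qed simp

lemma orient_opposite_sides_cross:
  assumes "orient a b c * orient a b d < 0" "orient c d a * orient c d b < 0"
  shows "closed_segment a b \<inter> closed_segment c d \<noteq> {}"
proof -
  \<comment> \<open>The parameters at which \<open>orient c d\<close> vanishes along
    \<open>a b\<close>, and \<open>orient a b\<close> along \<open>c d\<close>.\<close>
  define s where "s = orient c d a / (orient c d a - orient c d b)"
  define t where "t = orient a b c / (orient a b c - orient a b d)"
  have n: "orient c d a - orient c d b \<noteq> 0" "orient a b c - orient a b d \<noteq> 0"
    using assms by (auto simp: mult_less_0_iff)
  have st: "0 \<le> s" "s \<le> 1" "0 \<le> t" "t \<le> 1"
    using assms by (auto simp: s_def t_def mult_less_0_iff divide_simps)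
  \<comment> \<open>Both differences are, up to sign, the determinant of \<open>b - a\<close> and
    \<open>d - c\<close>, so \<open>s\<close> and \<open>t\<close> share one denominator.\<close>
  have eq: "orient c d a - orient c d b = - (orient a b c - orient a b d)"
    by (simp add: orient_def algebra_simps)
  have "(1 - s) *\<^sub>R a + s *\<^sub>R b = (1 - t) *\<^sub>R c + t *\<^sub>R d"
  proof -
    define D where "D = orient a b c - orient a b d"
    have D: "D \<noteq> 0" using n D_def by simp
    have s': "s * D = - orient c d a" and t': "t * D = orient a b c"
      using D unfolding s_def t_def eq D_def[symmetric] by auto
    have "D * ((1 - s) * fst a + s * fst b) = D * ((1 - t) * fst c + t * fst d)"
    proof -
      have "D * ((1 - s) * fst a + s * fst b) = D * fst a + (s * D) * (fst b - fst a)" by algebra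
      also have "\<dots> = D * fst c + (t * D) * (fst d - fst c)"
        unfolding s' t' by (simp add: D_def orient_def algebra_simps)
      also have "\<dots> = D * ((1 - t) * fst c + t * fst d)" by algebra
      finally show ?thesis .
    qed
    moreover have "D * ((1 - s) * snd a + s * snd b) = D * ((1 - t) * snd c + t * snd d)"
    proof -
      have "D * ((1 - s) * snd a + s * snd b) = D * snd a + (s * D) * (snd b - snd a)" by algebra
      also have "\<dots> = D * snd c + (t * D) * (snd d - snd c)"
        unfolding s' t' by (simp add: D_def orient_def algebra_simps)
      also have "\<dots> = D * ((1 - t) * snd c + t * snd d)" by algebra
      finally show ?thesis .
    qed
    ultimately show ?thesis using D by (simp add: prod_eq_iff)
  qed
  then show ?thesis using st by (auto simp: closed_segment_def)
qed

section \<open>Nested triangles and angular sectors\<close>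

text \<open>The segment \<open>v w'\<close> passes through \<open>u + (t / (1 - s)) (w - u)\<close>.
  As this point must not lie on \<open>u w\<close>, its factor exceeds 1, which makes the
  barycentric coordinates of \<open>w\<close> in the triangle \<open>u v w'\<close>
  nonnegative.\<close>

lemma triangles_nested_aux:
  fixes u v w w' :: "'a :: real_vector"
  assumes w': "w' = u + s *\<^sub>R (v - u) + t *\<^sub>R (w - u)" and "t > 0" "s < 0"
    and disj: "closed_segment v w' \<inter> closed_segment u w = {}"
  shows "w \<in> convex hull {u, v, w'}"
proof -
  have "t > 1 - s"
  proof (rule ccontr)
    assume "\<not> t > 1 - s"
    then have h: "0 \<le> t / (1 - s)" "t / (1 - s) \<le> 1" "0 \<le> 1 / (1 - s)" "1 / (1 - s) \<le> 1"
      using assms by (auto simp: divide_simps)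
    define k where "k = 1 / (1 - s)"
    have ks: "k * (1 - s) = 1" using \<open>s < 0\<close> by (simp add: k_def)
    have "v + k *\<^sub>R (w' - v) = v + k *\<^sub>R (t *\<^sub>R (w - u) - (1 - s) *\<^sub>R (v - u))"
      by (simp add: w' algebra_simps)
    also have "\<dots> = v + (k * t) *\<^sub>R (w - u) - (k * (1 - s)) *\<^sub>R (v - u)"
      by (simp add: scaleR_diff_right)
    also have "\<dots> = u + (k * t) *\<^sub>R (w - u)"
      by (simp add: ks)
    finally have "v + k *\<^sub>R (w' - v) = u + (k * t) *\<^sub>R (w - u)" .
    moreover have "v + k *\<^sub>R (w' - v) \<in> closed_segment v w'"
      unfolding in_segment using h by (intro exI[of _ k]) (auto simp: k_def algebra_simps)
    moreover have "u + (k * t) *\<^sub>R (w - u) \<in> closed_segment u w"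
      using h unfolding closed_segment_def k_def
      by (auto simp: algebra_simps intro!: exI[of _ "t / (1 - s)"])
    ultimately show False using disj by auto
  qed
  have "(1/t) *\<^sub>R (w' - u) = (s/t) *\<^sub>R (v - u) + w - u"
    using \<open>t > 0\<close> by (simp add: w' scaleR_add_right)
  then have "w = u + (- s/t) *\<^sub>R (v - u) + (1/t) *\<^sub>R (w' - u)" by simp
  moreover have "0 \<le> - s/t" "0 \<le> 1/t" "- s/t + 1/t \<le> 1"
    using assms \<open>t > 1 - s\<close> by (auto simp: divide_simps)
  ultimately show ?thesis unfolding convex_hull_3_alt by blast
qed

lemma triangles_nested:
  fixes u v w w' :: "'a :: real_vector"
  assumes w': "w' = u + s *\<^sub>R (v - u) + t *\<^sub>R (w - u)" and "t > 0"
    and disj: "closed_segment v w' \<inter> closed_segment u w = {}"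
      "closed_segment u w' \<inter> closed_segment v w = {}"
  shows "w' \<in> convex hull {u, v, w} \<or> w \<in> convex hull {u, v, w'}"
proof -
  consider "s \<ge> 0 \<and> s + t \<le> 1" | "s < 0" | "1 - s - t < 0" by linarith
  then show ?thesis
  proof cases
    case 1
    then show ?thesis using \<open>t > 0\<close> w' unfolding convex_hull_3_alt[of u v w] by force
  next
    case 2
    then show ?thesis using triangles_nested_aux[OF w' \<open>t > 0\<close> _ disj(1)] by blast
  next
    case 3
    \<comment> \<open>Exchanging \<open>u\<close> and \<open>v\<close> turns the negative
      coefficient \<open>1 - s - t\<close> into the \<open>s\<close> of the auxiliary lemma.\<close>
    have "w' = v + (1 - s - t) *\<^sub>R (u - v) + t *\<^sub>R (w - v)"
      by (simp add: w' algebra_simps)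
    from triangles_nested_aux[OF this \<open>t > 0\<close> 3 disj(2)]
    show ?thesis by (simp add: insert_commute)
  qed
qed

text \<open>The two equations are the Pluecker relations between orientations seen from a common point.\<close>

lemma cyclic_sign_sector:
  fixes d1 d2 d3 d4 p12 p23 p34 p41 p13 :: real
  assumes pos: "p12 > 0" "p23 > 0" "p34 > 0" "p41 > 0"
    and plucker: "p12 * d3 - p13 * d2 + p23 * d1 = 0" "p34 * d1 + p13 * d4 + p41 * d3 = 0"
  shows "(d1 \<ge> 0 \<and> d2 \<le> 0) \<or> (d2 \<ge> 0 \<and> d3 \<le> 0) \<or> (d3 \<ge> 0 \<and> d4 \<le> 0) \<or> (d4 \<ge> 0 \<and> d1 \<le> 0)"
proof (rule ccontr)
  assume "\<not> ?thesis"
  \<comment> \<open>Going round the four negated disjuncts, a nonnegative value makes the next one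
    positive, so all share a strict sign; the two relations then ask \<open>p13\<close> for opposite
    signs.\<close>
  then consider "d1 > 0" "d2 > 0" "d3 > 0" "d4 > 0" | "d1 < 0" "d2 < 0" "d3 < 0" "d4 < 0" by linarith
  then show False
  proof cases
    case 1
    then have "p13 * d2 > 0" "p13 * d4 < 0"
      using pos plucker by (smt (verit) mult_pos_pos)+
    then show False using 1 by (simp add: zero_less_mult_iff mult_less_0_iff)
  next
    case 2
    then have "p13 * d2 < 0" "p13 * d4 > 0"
      using pos plucker by (smt (verit) mult_pos_neg)+
    then show False using 2 by (simp add: zero_less_mult_iff mult_less_0_iff)
  qed
qed

text \<open>Otherwise \<open>s + t > 1\<close>, and shrinking \<open>y - q\<close> by
  \<open>1 / (s + t)\<close> gives a point of \<open>q y\<close> on the edge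
  \<open>x x'\<close>.\<close>

lemma sector_in_triangle:
  fixes q x x' y :: "'a :: real_vector"
  assumes y: "y = q + s *\<^sub>R (x - q) + t *\<^sub>R (x' - q)" and "s \<ge> 0" "t \<ge> 0"
    and disj: "closed_segment q y \<inter> closed_segment x x' = {}"
  shows "y \<in> convex hull {q, x, x'}"
proof (cases "s + t \<le> 1")
  case True
  then show ?thesis using assms unfolding convex_hull_3_alt by blast
next
  case False
  define k where "k = 1 / (s + t)"
  have k: "0 \<le> k" "k \<le> 1" "k * (s + t) = 1" using False by (auto simp: k_def)
  then have "k * s = 1 - k * t" by (simp add: algebra_simps)
  have "q + k *\<^sub>R (y - q) = q + (k * s) *\<^sub>R (x - q) + (k * t) *\<^sub>R (x' - q)"
    by (simp add: y scaleR_add_right)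
  also have "\<dots> = (1 - k * t) *\<^sub>R x + (k * t) *\<^sub>R x'"
    unfolding \<open>k * s = 1 - k * t\<close> by (simp add: algebra_simps)
  finally have "(1 - k) *\<^sub>R q + k *\<^sub>R y = (1 - k * t) *\<^sub>R x + (k * t) *\<^sub>R x'"
    by (simp add: algebra_simps)
  moreover have "0 \<le> k * t" "k * t \<le> 1"
    using k(1) assms(2,3) \<open>k * s = 1 - k * t\<close> mult_nonneg_nonneg[of k s] by auto
  ultimately have "(1 - k) *\<^sub>R q + k *\<^sub>R y \<in> closed_segment q y \<inter> closed_segment x x'"
    using k unfolding closed_segment_def by blast
  then show ?thesis using disj by simp
qed

text \<open>\<open>D\<close> is the determinant of the sides \<open>x4 - x1\<close> and \<open>x3 - x2\<close>. Its sign tells on which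
  side they converge, and it is negated when the roles of the base edges are exchanged.\<close>

lemma apex_orient:
  assumes "x3 \<in> convex hull {q, x1, x2}" "x4 \<in> convex hull {q, x1, x2}"
    and ne: "orient x1 x2 x3 \<noteq> 0" "orient x1 x2 x4 \<noteq> 0"
  defines "D \<equiv> (fst x4 - fst x1) * (snd x3 - snd x2) - (snd x4 - snd x1) * (fst x3 - fst x2)"
  shows "orient x1 x2 x3 * D > 0" "orient x1 x2 x4 * D > 0"
proof -
  have "{q, x1, x2} = {x1, x2, q}" by auto
  then obtain a' b' a b where x3: "x3 = x1 + b' *\<^sub>R (x2 - x1) + a' *\<^sub>R (q - x1)"
    and x4: "x4 = x1 + b *\<^sub>R (x2 - x1) + a *\<^sub>R (q - x1)"
    and c: "0 \<le> b'" "0 \<le> a'" "b' + a' \<le> 1" "0 \<le> b" "0 \<le> a" "b + a \<le> 1"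
    using assms(1,2) unfolding \<open>{q, x1, x2} = {x1, x2, q}\<close> convex_hull_3_alt by blast
  have o3: "orient x1 x2 x3 = a' * orient x1 x2 q" and o4: "orient x1 x2 x4 = a * orient x1 x2 q"
    by (simp_all add: x3 x4 orient_def algebra_simps)
  \<comment> \<open>The factor before \<open>orient x1 x2 q\<close> is positive, so \<open>D\<close>
    and both orientations over the base have the sign of \<open>orient x1 x2 q\<close>.\<close>
  have D: "D = (b * a' + a * (1 - b')) * orient x1 x2 q"
    by (simp add: D_def x3 x4 orient_def algebra_simps)
  have "a > 0" "a' > 0" "orient x1 x2 q \<noteq> 0" using ne c unfolding o3 o4 by auto
  moreover from this c have "a * (1 - b') > 0" by simp
  moreover have "b * a' \<ge> 0" using c by simp
  ultimately have *: "b * a' + a * (1 - b') > 0" "orient x1 x2 q * orient x1 x2 q > 0"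
    by (linarith, auto simp: zero_less_mult_iff)
  have "orient x1 x2 x3 * D = (a' * (b * a' + a * (1 - b'))) * (orient x1 x2 q * orient x1 x2 q)"
    "orient x1 x2 x4 * D = (a * (b * a' + a * (1 - b'))) * (orient x1 x2 q * orient x1 x2 q)"
    unfolding o3 o4 D by (simp_all add: algebra_simps)
  then show "orient x1 x2 x3 * D > 0" "orient x1 x2 x4 * D > 0"
    using * \<open>a > 0\<close> \<open>a' > 0\<close> by (simp_all)
qed

text \<open>The orientation over \<open>a b\<close> is proportional to the barycentric coordinate of
  \<open>q\<close>; if that vanishes, \<open>x\<close> lies on the base.\<close>

lemma orient_base_nonzero:
  assumes "x \<in> convex hull {q, a, b}" "orient a b q \<noteq> 0" "x \<notin> closed_segment a b"
  shows "orient a b x \<noteq> 0"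
proof
  assume 0: "orient a b x = 0"
  have "{q, a, b} = {a, b, q}" by auto
  then obtain s t where x: "x = a + s *\<^sub>R (b - a) + t *\<^sub>R (q - a)" "0 \<le> s" "0 \<le> t" "s + t \<le> 1"
    using assms(1) unfolding \<open>{q, a, b} = {a, b, q}\<close> convex_hull_3_alt by blast
  have "orient a b x = t * orient a b q"
    by (simp add: x(1) orient_def algebra_simps)
  then have "t = 0" using 0 assms(2) by simp
  then have "x \<in> closed_segment a b"
    using x unfolding in_segment by (auto simp: algebra_simps intro!: exI[of _ s])
  then show False using assms(3) by simp
qed

text \<open>Exchanging the bases \<open>x1 x2\<close> and \<open>x3 x4\<close> negates the
  determinant of the sides, so orientations over the two bases have opposite signs. This is the sign
  pattern of crossing sides.\<close>

lemma opposite_apexes_cross: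
  assumes "x3 \<in> convex hull {q, x1, x2}" "x4 \<in> convex hull {q, x1, x2}"
    and "x1 \<in> convex hull {q', x3, x4}" "x2 \<in> convex hull {q', x3, x4}"
    and ne: "orient x1 x2 x3 \<noteq> 0" "orient x1 x2 x4 \<noteq> 0" "orient x3 x4 x1 \<noteq> 0" "orient x3 x4 x2 \<noteq> 0"
  shows "closed_segment x2 x3 \<inter> closed_segment x4 x1 \<noteq> {}"
proof -
  define D where "D = (fst x4 - fst x1) * (snd x3 - snd x2) - (snd x4 - snd x1) * (fst x3 - fst x2)"
  have 1: "orient x1 x2 x3 * D > 0" "orient x1 x2 x4 * D > 0"
    using apex_orient[OF assms(1,2) ne(1,2)] unfolding D_def by auto
  have "(fst x2 - fst x3) * (snd x1 - snd x4) - (snd x2 - snd x3) * (fst x1 - fst x4) = - D"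
    by (simp add: D_def algebra_simps)
  then have 2: "orient x3 x4 x1 * (- D) > 0" "orient x3 x4 x2 * (- D) > 0"
    using apex_orient[OF assms(3,4) ne(3,4)] by auto
  have perm: "orient x2 x3 x4 = orient x3 x4 x2" "orient x2 x3 x1 = orient x1 x2 x3"
    "orient x4 x1 x2 = orient x1 x2 x4" "orient x4 x1 x3 = orient x3 x4 x1"
    by (simp_all add: orient_def algebra_simps)
  have "orient x1 x2 x3 * orient x3 x4 x2 < 0" "orient x1 x2 x4 * orient x3 x4 x1 < 0"
    using 1 2 by (auto simp: zero_less_mult_iff mult_less_0_iff)
  then show ?thesis
    by (intro orient_opposite_sides_cross) (auto simp: perm mult.commute)
qed

section \<open>Planar straight-line drawings\<close>

text \<open>The vertex set argument of \<^const>\<open>planar_straight_line_drawing\<close> is a dummy.\<close>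

locale frame_drawing =
  fixes E :: "'v set set" and p :: "'v \<Rightarrow> real \<times> real" and S :: "'v set"
  assumes drawing: "\<And>V. planar_straight_line_drawing V E p S"
begin

definition adj :: "'v \<Rightarrow> 'v \<Rightarrow> bool" where
  "adj u v \<longleftrightarrow> u \<in> S \<and> v \<in> S \<and> u \<noteq> v \<and> {u, v} \<in> E"

abbreviation tri :: "'v \<Rightarrow> 'v \<Rightarrow> 'v \<Rightarrow> (real \<times> real) set" where
  "tri u v w \<equiv> convex hull {p u, p v, p w}"

lemma adj_commute: "adj u v \<longleftrightarrow> adj v u"
  by (auto simp: adj_def insert_commute)

lemma adjD: "adj u v \<Longrightarrow> u \<in> S" "adj u v \<Longrightarrow> v \<in> S" "adj u v \<Longrightarrow> u \<noteq> v"
  by (auto simp: adj_def)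

lemma adj_irrefl [simp]: "\<not> adj u u"
  by (simp add: adj_def)

lemma p_eq_iff: "u \<in> S \<Longrightarrow> v \<in> S \<Longrightarrow> p u = p v \<longleftrightarrow> u = v"
  using drawing by (auto simp: planar_straight_line_drawing_def inj_on_def)

lemma vertex_notin_edge:
  assumes "adj u v" "w \<in> S" "w \<noteq> u" "w \<noteq> v"
  shows "p w \<notin> closed_segment (p u) (p v)"
  using assms drawing by (auto simp: planar_straight_line_drawing_def adj_def)

lemma edges_disjoint:
  assumes "adj u v" "adj x y" "u \<noteq> x" "u \<noteq> y" "v \<noteq> x" "v \<noteq> y"
  shows "closed_segment (p u) (p v) \<inter> closed_segment (p x) (p y) = {}"
proof -
  have "{u, v} \<noteq> {x, y}" "{u, v} \<inter> {x, y} = {}" using assms by auto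
  moreover have "closed_segment (p u) (p v) \<inter> closed_segment (p x) (p y) \<subseteq> p ` ({u, v} \<inter> {x, y})"
    using drawing assms \<open>{u, v} \<noteq> {x, y}\<close>
    unfolding planar_straight_line_drawing_def adj_def by blast
  ultimately show ?thesis by simp
qed

lemma triangle_not_collinear:
  assumes "adj u v" "w \<in> S" "w \<noteq> u" "w \<noteq> v" "adj v w" "adj u w"
  shows "\<not> collinear {p u, p v, p w}"
  using assms vertex_notin_edge[of u v w] vertex_notin_edge[of v w u] vertex_notin_edge[of w u v]
  by (auto simp: collinear_between_cases between_mem_segment adj_def insert_commute)

lemma triangle_orient:
  assumes "adj u v" "adj v w" "adj u w"
  shows "orient (p u) (p v) (p w) \<noteq> 0"
  using triangle_not_collinear[of u v w] orient_0_imp_collinear assms adjD by metis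

section \<open>Separation and nesting by drawn triangles\<close>

text \<open>A segment leaving the triangle meets its frontier, which consists of three drawn edges
  sharing no endpoint with \<open>x y\<close>.\<close>

lemma triangle_separates:
  assumes "adj u v" "adj v w" "adj u w" "adj x y"
    and "x \<notin> {u, v, w}" "y \<notin> {u, v, w}" "p x \<in> tri u v w"
  shows "p y \<in> tri u v w"
proof (rule ccontr)
  assume "p y \<notin> tri u v w"
  then have "closed_segment (p x) (p y) \<inter> frontier (tri u v w) \<noteq> {}"
    using assms(7) by (intro connected_Int_frontier) auto
  moreover have "frontier (tri u v w) =
      closed_segment (p u) (p v) \<union> closed_segment (p v) (p w) \<union> closed_segment (p u) (p w)"
    by (subst frontier_of_triangle) (auto simp: closed_segment_commute)
  moreover have "closed_segment (p x) (p y) \<inter> closed_segment (p u) (p v) = {}"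
    "closed_segment (p x) (p y) \<inter> closed_segment (p v) (p w) = {}"
    "closed_segment (p x) (p y) \<inter> closed_segment (p u) (p w) = {}"
    by (rule edges_disjoint; use assms in blast)+
  ultimately show False by blast
qed

text \<open>The two hulls coincide; the corners of a nondegenerate triangle are extreme points, and
  these are among the generators of any hull. This refutes triangles that enclose each
  other.\<close>

lemma mutually_inscribed_triangles:
  assumes "adj u v" "adj v w" "adj u w"
    and "p u' \<in> tri u v w" "p v' \<in> tri u v w" "p w' \<in> tri u v w"
    and "p u \<in> tri u' v' w'" "p v \<in> tri u' v' w'" "p w \<in> tri u' v' w'"
    and "u' \<in> S" "v' \<in> S" "w' \<in> S"
  shows "u \<in> {u', v', w'} \<and> v \<in> {u', v', w'} \<and> w \<in> {u', v', w'}"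
proof -
  have "tri u v w \<subseteq> tri u' v' w'" "tri u' v' w' \<subseteq> tri u v w"
    by (rule hull_minimal; use assms in simp)+
  then have "tri u v w = tri u' v' w'" by blast
  moreover have "\<not> affine_dependent {p u, p v, p w}"
    using triangle_not_collinear[of u v w] assms adjD[of _ w] adjD[of u] adjD[of v]
    unfolding collinear_3_eq_affine_dependent by metis
  then have "x extreme_point_of tri u v w" if "x \<in> {p u, p v, p w}" for x
    using that extreme_point_of_convex_hull_affine_independent by blast
  ultimately have "{p u, p v, p w} \<subseteq> {p u', p v', p w'}"
    using extreme_point_of_convex_hull by fastforce
  then show ?thesis using assms p_eq_iff adjD by auto
qed

text \<open>The positive quotient puts \<open>w\<close> and \<open>w'\<close> on one side of the
  edge \<open>u v\<close>, and the edges joining them to \<open>u\<close> and \<open>v\<close>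
  cannot cross.\<close>

lemma triangles_on_edge_nested:
  assumes "adj u v" "adj u w" "adj v w" "adj u w'" "adj v w'" "w \<noteq> w'"
    and "orient (p u) (p v) (p w') / orient (p u) (p v) (p w) > 0"
  shows "p w' \<in> tri u v w \<or> p w \<in> tri u v w'"
proof (rule triangles_nested)
  show "p w' = p u + (orient (p u) (p w') (p w) / orient (p u) (p v) (p w)) *\<^sub>R (p v - p u)
      + (orient (p u) (p v) (p w') / orient (p u) (p v) (p w)) *\<^sub>R (p w - p u)"
    using triangle_orient[of u v w] assms by (intro orient_cramer) auto
  show "closed_segment (p v) (p w') \<inter> closed_segment (p u) (p w) = {}"
    "closed_segment (p u) (p w') \<inter> closed_segment (p v) (p w) = {}"
    by (rule edges_disjoint; use assms adjD(3) in blast)+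
qed (use assms in auto)

text \<open>The barycentric coordinates of \<open>r\<close> in \<open>a b c\<close> sum to 1, so one
  is positive; the two triangles over the edge opposite to that corner are then nested.\<close>

lemma four_clique_nested:
  assumes "adj a b" "adj b c" "adj a c" "adj r a" "adj r b" "adj r c"
  shows "p r \<in> tri a b c \<or> p a \<in> tri r b c \<or> p b \<in> tri a r c \<or> p c \<in> tri a b r"
proof -
  let ?o = "\<lambda>u v w. orient (p u) (p v) (p w)"
  have "?o r b c + ?o a r c + ?o a b r = ?o a b c" by (simp add: orient_def algebra_simps)
  moreover have "?o a b c \<noteq> 0" using triangle_orient assms by blast
  ultimately have "?o r b c / ?o a b c + ?o a r c / ?o a b c + ?o a b r / ?o a b c = 1"
    by (simp flip: add_divide_distrib)
  then consider "?o r b c / ?o a b c > 0" | "?o a r c / ?o a b c > 0" | "?o a b r / ?o a b c > 0"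
    by linarith
  then show ?thesis
  proof cases
    case 1
    have "?o b c r = ?o r b c" "?o b c a = ?o a b c" by (simp_all add: orient_def algebra_simps)
    then show ?thesis using triangles_on_edge_nested[of b c a r] assms 1 adjD
      by (auto simp: adj_commute insert_commute)
  next
    case 2
    have "?o a c r = - ?o a r c" "?o a c b = - ?o a b c" by (simp_all add: orient_def algebra_simps)
    then show ?thesis using triangles_on_edge_nested[of a c b r] assms 2 adjD
      by (auto simp: adj_commute insert_commute)
  next
    case 3
    then show ?thesis using triangles_on_edge_nested[of a b c r] assms adjD
      by (auto simp: adj_commute insert_commute)
  qed
qed

section \<open>Excluding five common neighbours\<close>

text \<open>The innermost \<open>q3\<close> draws \<open>z\<close> into the triangle over
  \<open>q2\<close>, and \<open>z\<close> draws the outermost \<open>q1\<close> there too, so the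
  triangles over \<open>q1\<close> and \<open>q2\<close> enclose each other.\<close>

lemma no_three_nested_with_common_neighbour:
  assumes "adj u v" "z \<noteq> u" "z \<noteq> v"
    and "adj q1 u" "adj q1 v" "adj q1 z" "adj q2 u" "adj q2 v" "adj q2 z"
      "adj q3 u" "adj q3 v" "adj q3 z"
    and "q1 \<noteq> q2" "q2 \<noteq> q3" "p q2 \<in> tri u v q1" "p q3 \<in> tri u v q2"
  shows False
proof -
  have z: "p z \<in> tri u v q2"
    using assms adjD by (intro triangle_separates[of u v q2 q3 z]) (auto simp: adj_commute)
  have "p q1 \<in> tri u v q2"
    using assms adjD z by (intro triangle_separates[of u v q2 z q1]) (auto simp: adj_commute)
  moreover have "p u \<in> tri u v q" "p v \<in> tri u v q" for q by (auto intro: hull_inc)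
  ultimately have "q1 \<in> {u, v, q2}"
    using mutually_inscribed_triangles[of u v q1 u v q2] assms adjD(1,2)[OF assms(1)]
      adjD(1)[OF assms(7)] by (simp add: adj_commute)
  then show False using assms(4,5,13) by auto
qed

text \<open>Three of the five lie on one side of the edge \<open>u v\<close>, and their triangles
  over it are nested in pairs.\<close>

lemma no_three_by_five:
  assumes "adj u v" "z \<noteq> u" "z \<noteq> v" "finite W" "card W \<ge> 5"
    and W: "\<And>q. q \<in> W \<Longrightarrow> adj q u \<and> adj q v \<and> adj q z"
  shows False
proof -
  let ?o = "\<lambda>q. orient (p u) (p v) (p q)"
  define P where "P = {q \<in> W. ?o q > 0}"
  define N where "N = {q \<in> W. ?o q < 0}"
  have "?o q \<noteq> 0" if "q \<in> W" for q
    using triangle_orient assms(1) W that adj_commute by blast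
  then have "W = P \<union> N" unfolding P_def N_def by force
  then have "card W \<le> card P + card N" using card_Un_le by metis
  then have "card P \<ge> 3 \<or> card N \<ge> 3" using assms(5) by linarith
  then obtain T where T: "T \<subseteq> W" "card T \<ge> 3"
      and side: "\<And>q q'. q \<in> T \<Longrightarrow> q' \<in> T \<Longrightarrow> ?o q' / ?o q > 0"
    by (auto simp: P_def N_def zero_less_divide_iff intro: that[of P] that[of N])
  obtain T' where "T' \<subseteq> T" "card T' = 3" using T(2) obtain_subset_with_card_n by metis
  then obtain a b c where abc: "a \<in> T" "b \<in> T" "c \<in> T" "a \<noteq> b" "b \<noteq> c" "a \<noteq> c"
    by (auto simp: card_3_iff)
  have cmp: "p q' \<in> tri u v q \<or> p q \<in> tri u v q'" if "q \<in> T" "q' \<in> T" "q \<noteq> q'" for q q'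
    using triangles_on_edge_nested[of u v q q'] side W T(1) that assms(1) by (auto simp: adj_commute)
  have no: False if "q1 \<in> T" "q2 \<in> T" "q3 \<in> T" "q1 \<noteq> q2" "q2 \<noteq> q3"
    "p q2 \<in> tri u v q1" "p q3 \<in> tri u v q2" for q1 q2 q3
    using no_three_nested_with_common_neighbour[of u v z q1 q2 q3] assms(1-3) W T(1) that by blast
  \<comment> \<open>Nesting orients each of the three pairs, and a tournament on three vertices has
    a directed path through all of them.\<close>
  show False using cmp[of a b] cmp[of b c] cmp[of a c] no abc by metis
qed

subsection \<open>Wheels\<close>

definition wheel :: "'v \<Rightarrow> 'v \<Rightarrow> 'v \<Rightarrow> 'v \<Rightarrow> 'v \<Rightarrow> bool" where
  "wheel q x1 x2 x3 x4 \<longleftrightarrow> distinct [q, x1, x2, x3, x4] \<and>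
     adj q x1 \<and> adj q x2 \<and> adj q x3 \<and> adj q x4 \<and>
     adj x1 x2 \<and> adj x2 x3 \<and> adj x3 x4 \<and> adj x4 x1"

text \<open>The hub is outside the rim, which is then enclosed by the triangle over \<open>x1 x2\<close>.\<close>

definition contains_rim :: "'v \<Rightarrow> 'v \<Rightarrow> 'v \<Rightarrow> 'v \<Rightarrow> 'v \<Rightarrow> bool" where
  "contains_rim q x1 x2 x3 x4 \<longleftrightarrow> p x3 \<in> tri q x1 x2 \<and> p x4 \<in> tri q x1 x2"

definition external_hub :: "'v \<Rightarrow> 'v \<Rightarrow> 'v \<Rightarrow> 'v \<Rightarrow> 'v \<Rightarrow> bool" where
  "external_hub q x1 x2 x3 x4 \<longleftrightarrow> contains_rim q x1 x2 x3 x4 \<or> contains_rim q x2 x3 x4 x1 \<or>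
     contains_rim q x3 x4 x1 x2 \<or> contains_rim q x4 x1 x2 x3"

lemma wheel_rotate: "wheel q x1 x2 x3 x4 \<Longrightarrow> wheel q x2 x3 x4 x1"
  by (auto simp: wheel_def)

lemma wheel_reverse: "wheel q x1 x2 x3 x4 \<Longrightarrow> wheel q x4 x3 x2 x1"
  by (auto simp: wheel_def adj_commute)

lemma contains_rim_all:
  assumes "contains_rim q x1 x2 x3 x4"
  shows "{p q, p x1, p x2, p x3, p x4} \<subseteq> tri q x1 x2"
  using assms by (auto simp: contains_rim_def intro: hull_inc)

lemma external_hubE:
  assumes "external_hub q x1 x2 x3 x4" "wheel q x1 x2 x3 x4"
  obtains a b c d where "wheel q a b c d" "{a, b, c, d} = {x1, x2, x3, x4}" "contains_rim q a b c d"
proof -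
  have "wheel q x2 x3 x4 x1" "wheel q x3 x4 x1 x2" "wheel q x4 x1 x2 x3"
    using assms(2) wheel_rotate by blast+
  moreover have "{x2, x3, x4, x1} = {x1, x2, x3, x4}" "{x3, x4, x1, x2} = {x1, x2, x3, x4}"
    "{x4, x1, x2, x3} = {x1, x2, x3, x4}" by auto
  ultimately show thesis using assms that unfolding external_hub_def by metis
qed

lemma rim_in_triangle:
  assumes "wheel q x1 x2 x3 x4" "p x3 \<in> tri q x1 x2 \<or> p x4 \<in> tri q x1 x2"
  shows "contains_rim q x1 x2 x3 x4"
  using assms triangle_separates[of q x1 x2 x3 x4] triangle_separates[of q x1 x2 x4 x3]
  by (auto simp: contains_rim_def wheel_def adj_commute)

text \<open>Opposite turns put \<open>x1\<close> and \<open>x3\<close> on the same side of the spoke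
  \<open>q x2\<close>, so the two triangles over this spoke are nested.\<close>

lemma turn_contains_rim:
  assumes "wheel q x1 x2 x3 x4"
    and "orient (p q) (p x1) (p x2) * orient (p q) (p x2) (p x3) < 0"
  shows "contains_rim q x1 x2 x3 x4 \<or> contains_rim q x2 x3 x4 x1"
proof -
  have "orient (p q) (p x2) (p x1) = - orient (p q) (p x1) (p x2)"
    by (simp add: orient_def algebra_simps)
  then have "orient (p q) (p x2) (p x3) / orient (p q) (p x2) (p x1) > 0"
    using assms(2) by (auto simp: zero_less_divide_iff divide_less_0_iff mult_less_0_iff)
  then have "p x3 \<in> tri q x2 x1 \<or> p x1 \<in> tri q x2 x3"
    using assms(1) by (intro triangles_on_edge_nested) (auto simp: wheel_def adj_commute)
  then have "p x3 \<in> tri q x1 x2 \<or> p x1 \<in> tri q x2 x3"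
    by (simp add: insert_commute)
  then show ?thesis using rim_in_triangle assms(1) wheel_rotate by blast
qed

section \<open>Locating a vertex relative to a wheel\<close>

text \<open>The signs place \<open>y\<close> in the sector at \<open>q\<close> between
  \<open>x\<close> and \<open>x'\<close>, and the edge \<open>q y\<close> cannot leave through
  \<open>x x'\<close>.\<close>

lemma sector_vertex_in_triangle:
  assumes "adj q x" "adj x x'" "adj q x'" "adj q y" "y \<noteq> x" "y \<noteq> x'"
    and "orient (p q) (p x) (p x') > 0" "orient (p q) (p x) (p y) \<ge> 0" "orient (p q) (p x') (p y) \<le> 0"
  shows "p y \<in> tri q x x'"
proof (rule sector_in_triangle)
  show "p y = p q + (orient (p q) (p y) (p x') / orient (p q) (p x) (p x')) *\<^sub>R (p x - p q)
      + (orient (p q) (p x) (p y) / orient (p q) (p x) (p x')) *\<^sub>R (p x' - p q)"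
    using assms by (intro orient_cramer) auto
  have "orient (p q) (p y) (p x') = - orient (p q) (p x') (p y)"
    by (simp add: orient_def algebra_simps)
  then show "0 \<le> orient (p q) (p y) (p x') / orient (p q) (p x) (p x')"
    using assms by (simp add: divide_nonpos_pos)
  show "closed_segment (p q) (p y) \<inter> closed_segment (p x) (p x') = {}"
    by (rule edges_disjoint; use assms adjD(3) in blast)
qed (use assms in auto)

definition in_wheel :: "'v \<Rightarrow> 'v \<Rightarrow> 'v \<Rightarrow> 'v \<Rightarrow> 'v \<Rightarrow> 'v \<Rightarrow> bool" where
  "in_wheel y q x1 x2 x3 x4 \<longleftrightarrow>
     p y \<in> tri q x1 x2 \<or> p y \<in> tri q x2 x3 \<or> p y \<in> tri q x3 x4 \<or> p y \<in> tri q x4 x1"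

text \<open>Since all four triangles turn the same way about \<open>q\<close>, their sectors cover
  every direction.\<close>

lemma in_positive_wheel:
  assumes w: "wheel q x1 x2 x3 x4" and y: "adj q y" "y \<notin> {x1, x2, x3, x4}"
    and pos: "orient (p q) (p x1) (p x2) > 0" "orient (p q) (p x2) (p x3) > 0"
      "orient (p q) (p x3) (p x4) > 0" "orient (p q) (p x4) (p x1) > 0"
  shows "in_wheel y q x1 x2 x3 x4"
proof -
  let ?d = "\<lambda>x. orient (p q) (p x) (p y)"
  have "(?d x1 \<ge> 0 \<and> ?d x2 \<le> 0) \<or> (?d x2 \<ge> 0 \<and> ?d x3 \<le> 0) \<or> (?d x3 \<ge> 0 \<and> ?d x4 \<le> 0)
      \<or> (?d x4 \<ge> 0 \<and> ?d x1 \<le> 0)"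
    by (rule cyclic_sign_sector[OF pos, where ?p13.0 = "orient (p q) (p x1) (p x3)"])
      (simp_all add: orient_def algebra_simps)
  then show ?thesis unfolding in_wheel_def
    using sector_vertex_in_triangle[of q _ _ y] w y pos unfolding wheel_def by auto
qed

text \<open>A change of turn between consecutive triangles would make the hub external, so all four
  turn alike; the clockwise case is the reversed wheel.\<close>

lemma in_wheel_if_internal_hub:
  assumes w: "wheel q x1 x2 x3 x4" and y: "adj q y" "y \<notin> {x1, x2, x3, x4}"
    and "\<not> external_hub q x1 x2 x3 x4"
  shows "in_wheel y q x1 x2 x3 x4"
proof -
  let ?o = "\<lambda>a b. orient (p q) (p a) (p b)"
  have w': "wheel q x2 x3 x4 x1" "wheel q x3 x4 x1 x2" "wheel q x4 x1 x2 x3"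
    using w wheel_rotate by blast+
  have "\<not> ?o x1 x2 * ?o x2 x3 < 0" "\<not> ?o x2 x3 * ?o x3 x4 < 0" "\<not> ?o x3 x4 * ?o x4 x1 < 0"
    using turn_contains_rim[OF w] turn_contains_rim[OF w'(1)] turn_contains_rim[OF w'(2)] assms(4)
    unfolding external_hub_def by blast+
  moreover have "?o x1 x2 \<noteq> 0" "?o x2 x3 \<noteq> 0" "?o x3 x4 \<noteq> 0" "?o x4 x1 \<noteq> 0"
    using w triangle_orient unfolding wheel_def by auto
  ultimately consider "?o x1 x2 > 0" "?o x2 x3 > 0" "?o x3 x4 > 0" "?o x4 x1 > 0"
    | "?o x1 x2 < 0" "?o x2 x3 < 0" "?o x3 x4 < 0" "?o x4 x1 < 0"
    by (auto simp: mult_less_0_iff not_less)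
  then show ?thesis
  proof cases
    case 1
    then show ?thesis using in_positive_wheel w y by blast
  next
    case 2
    have neg: "?o a b = - ?o b a" for a b by (simp add: orient_def algebra_simps)
    have "in_wheel y q x4 x3 x2 x1"
      using in_positive_wheel[OF wheel_reverse[OF w]] y 2 neg[of x4 x3] neg[of x3 x2]
        neg[of x2 x1] neg[of x1 x4] by auto
    then show ?thesis unfolding in_wheel_def by (auto simp: insert_commute)
  qed
qed

lemma in_wheelE:
  assumes "in_wheel y q x1 x2 x3 x4" "wheel q x1 x2 x3 x4"
  obtains a b c d where "wheel q a b c d" "{a, b, c, d} = {x1, x2, x3, x4}" "p y \<in> tri q a b"
proof -
  have "wheel q x2 x3 x4 x1" "wheel q x3 x4 x1 x2" "wheel q x4 x1 x2 x3"
    using assms(2) wheel_rotate by blast+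
  moreover have "{x2, x3, x4, x1} = {x1, x2, x3, x4}" "{x3, x4, x1, x2} = {x1, x2, x3, x4}"
    "{x4, x1, x2, x3} = {x1, x2, x3, x4}" by auto
  ultimately show thesis using assms that unfolding in_wheel_def by metis
qed

text \<open>Membership in the triangle passes along each rim edge, because no rim vertex is a
  corner.\<close>

lemma rim_follows:
  assumes "wheel q x1 x2 x3 x4" "adj u v" "adj v w" "adj u w"
    and "{x1, x2, x3, x4} \<inter> {u, v, w} = {}" "y \<in> {x1, x2, x3, x4}" "p y \<in> tri u v w"
  shows "\<forall>x \<in> {x1, x2, x3, x4}. p x \<in> tri u v w"
proof -
  have step: "p b \<in> tri u v w" if "adj a b" "a \<in> {x1, x2, x3, x4}" "b \<in> {x1, x2, x3, x4}"
      "p a \<in> tri u v w" for a b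
    using triangle_separates[of u v w a b] assms that by blast
  have "p x1 \<in> tri u v w \<Longrightarrow> p x2 \<in> tri u v w" "p x2 \<in> tri u v w \<Longrightarrow> p x3 \<in> tri u v w"
    "p x3 \<in> tri u v w \<Longrightarrow> p x4 \<in> tri u v w" "p x4 \<in> tri u v w \<Longrightarrow> p x1 \<in> tri u v w"
    using assms(1) step unfolding wheel_def by auto
  then show ?thesis using assms(6,7) by auto
qed

section \<open>Two hubs over common rims\<close>

text \<open>The triangle of an external hub holds the whole rim, and an enclosed rim vertex draws in
  the other hub; two external hubs would have triangles enclosing each other.\<close>

lemma common_rim_external_hubs:
  assumes w: "wheel q x1 x2 x3 x4" "wheel q' x1 x2 x3 x4" and "q \<noteq> q'"
  shows "\<not> (external_hub q x1 x2 x3 x4 \<and> external_hub q' x1 x2 x3 x4)"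
proof
  assume *: "external_hub q x1 x2 x3 x4 \<and> external_hub q' x1 x2 x3 x4"
  obtain a b c d where abcd: "wheel q a b c d" "{a, b, c, d} = {x1, x2, x3, x4}" "contains_rim q a b c d"
    using * w external_hubE by metis
  obtain a' b' c' d' where abcd': "wheel q' a' b' c' d'" "{a', b', c', d'} = {x1, x2, x3, x4}"
    "contains_rim q' a' b' c' d'"
    using * w external_hubE by metis
  have adjs: "adj q' y" "adj q y" if "y \<in> {x1, x2, x3, x4}" for y
    using w that unfolding wheel_def by auto
  have ne: "q \<notin> {x1, x2, x3, x4}" "q' \<notin> {x1, x2, x3, x4}" using w by (auto simp: wheel_def)
  have "p q' \<in> tri q a b"
    by (rule triangle_separates[of q a b c q'])
      (use abcd adjs[of c] ne \<open>q \<noteq> q'\<close> in \<open>auto simp: wheel_def adj_commute contains_rim_def\<close>)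
  moreover have "p q \<in> tri q' a' b'"
    by (rule triangle_separates[of q' a' b' c' q])
      (use abcd' adjs[of c'] ne \<open>q \<noteq> q'\<close> in \<open>auto simp: wheel_def adj_commute contains_rim_def\<close>)
  moreover have "p y \<in> tri q a b" "p y \<in> tri q' a' b'" if "y \<in> {x1, x2, x3, x4}" for y
  proof -
    have "y \<in> {a, b, c, d}" "y \<in> {a', b', c', d'}" using that abcd(2) abcd'(2) by simp_all
    then show "p y \<in> tri q a b" "p y \<in> tri q' a' b'"
      using contains_rim_all[OF abcd(3)] contains_rim_all[OF abcd'(3)] by auto
  qed
  moreover have "a \<in> {x1, x2, x3, x4}" "b \<in> {x1, x2, x3, x4}" "a' \<in> {x1, x2, x3, x4}" "b' \<in> {x1, x2, x3, x4}"
    using abcd(2) abcd'(2) by blast+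
  ultimately have "q \<in> {q', a', b'}"
    using mutually_inscribed_triangles[of q a b q' a' b'] abcd(1) abcd'(1)
    unfolding wheel_def by (auto dest: adjD)
  then show False using ne \<open>q \<noteq> q'\<close> \<open>a' \<in> _\<close> \<open>b' \<in> _\<close> by auto
qed

text \<open>If the hub is internal to both rims, each rim has a vertex in a triangle of the other
  wheel and follows it there entirely, so two triangles enclose each other.\<close>

lemma common_hub_external:
  assumes w: "wheel q x1 x2 x3 x4" "wheel q y1 y2 y3 y4"
    and disj: "{x1, x2, x3, x4} \<inter> {y1, y2, y3, y4} = {}"
  shows "external_hub q x1 x2 x3 x4 \<or> external_hub q y1 y2 y3 y4"
proof (rule ccontr)
  assume *: "\<not> ?thesis"
  have "in_wheel y1 q x1 x2 x3 x4" "in_wheel x1 q y1 y2 y3 y4"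
    using in_wheel_if_internal_hub[OF w(1), of y1] in_wheel_if_internal_hub[OF w(2), of x1] * w disj
    unfolding wheel_def by auto
  then obtain a b c d a' b' c' d'
    where abcd: "wheel q a b c d" "{a, b, c, d} = {x1, x2, x3, x4}" "p y1 \<in> tri q a b"
      and abcd': "wheel q a' b' c' d'" "{a', b', c', d'} = {y1, y2, y3, y4}" "p x1 \<in> tri q a' b'"
    using w in_wheelE by metis
  have mem: "a \<in> {x1, x2, x3, x4}" "b \<in> {x1, x2, x3, x4}" "a' \<in> {y1, y2, y3, y4}" "b' \<in> {y1, y2, y3, y4}"
    using abcd(2) abcd'(2) by blast+
  have qn: "q \<notin> {x1, x2, x3, x4}" "q \<notin> {y1, y2, y3, y4}" using w by (auto simp: wheel_def)
  have "{x1, x2, x3, x4} \<inter> {q, a', b'} = {}" "{y1, y2, y3, y4} \<inter> {q, a, b} = {}"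
    using mem qn disj by auto
  then have "\<forall>x\<in>{x1, x2, x3, x4}. p x \<in> tri q a' b'" "\<forall>x\<in>{y1, y2, y3, y4}. p x \<in> tri q a b"
    using rim_follows[OF w(1), of q a' b' x1] rim_follows[OF w(2), of q a b y1] abcd abcd'
    unfolding wheel_def by auto
  then have "a \<in> {q, a', b'}"
    using mutually_inscribed_triangles[of q a b q a' b'] abcd(1) abcd'(1) mem
    unfolding wheel_def by (auto dest: adjD intro: hull_inc)
  then show False using mem qn disj by auto
qed

text \<open>Each hub is external to at least two of the three rims, so two hubs would both be
  external to a common one.\<close>

lemma no_two_common_hubs:
  assumes "wheel q x1 x2 x3 x4" "wheel q y1 y2 y3 y4" "wheel q z1 z2 z3 z4"
    and "wheel q' x1 x2 x3 x4" "wheel q' y1 y2 y3 y4" "wheel q' z1 z2 z3 z4"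
    and "{x1, x2, x3, x4} \<inter> {y1, y2, y3, y4} = {}" "{x1, x2, x3, x4} \<inter> {z1, z2, z3, z4} = {}"
      "{y1, y2, y3, y4} \<inter> {z1, z2, z3, z4} = {}"
  shows "q = q'"
  using assms common_rim_external_hubs common_hub_external by metis

text \<open>If \<open>r\<close> is outside the triangle \<open>q x1 x2\<close>, these four vertices form a \<open>K\<^bsub>4\<^esub>\<close> with that
  triangle as a face, and it is the only face touching \<open>q\<close>, \<open>x1\<close> and \<open>x2\<close>; the edge \<open>x3 x4\<close> has
  neighbours on all three, so it lies there.\<close>

lemma contains_rim_or_in_triangle:
  assumes w: "wheel q x1 x2 x3 x4" and r: "adj r q" "adj r x1" "adj r x2" "r \<noteq> x3" "r \<noteq> x4"
    and out: "p r \<notin> tri q x1 x2"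
  shows "contains_rim q x1 x2 x3 x4"
proof -
  \<comment> \<open>Here \<open>a\<close> stands for the corner of \<open>q x1 x2\<close> lying
    inside the triangle of \<open>r\<close> and the other two corners; the three choices are treated
    alike.\<close>
  have key: "p x3 \<in> tri a b c \<or> p x4 \<in> tri a b c"
    if "p a \<in> tri r b c" "adj a b" "adj b c" "adj a c" "adj r a" "adj r b" "adj r c"
      and sets: "{a, b, c} \<inter> {r, x3, x4} = {}"
      and nb: "adj a x3 \<or> adj a x4" "adj b x3 \<or> adj b x4" "adj c x3 \<or> adj c x4"
    for a b c
  proof -
    have x34: "adj x3 x4" using w by (simp add: wheel_def)
    have both: "p x \<in> tri u v w'" if "p y \<in> tri u v w'" "adj u v" "adj v w'" "adj u w'" "{u, v, w'} \<inter> {x3, x4} = {}"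
      "y \<in> {x3, x4}" "x \<in> {x3, x4}" for u v w' x y
      using triangle_separates[of u v w' x3 x4] triangle_separates[of u v w' x4 x3] x34 that
      by (auto simp: adj_commute)
    have follow: "p t \<in> tri u v w'" if "p x3 \<in> tri u v w'" "adj u v" "adj v w'" "adj u w'"
      "{u, v, w'} \<inter> {x3, x4} = {}" "t \<notin> {u, v, w', x3, x4}" "adj t x3 \<or> adj t x4" for t u v w'
      using triangle_separates[of u v w' x3 t] triangle_separates[of u v w' x4 t]
        both[of x3 u v w' x4] that by (auto simp: adj_commute)
    obtain y where y: "y \<in> {x3, x4}" "adj a y" using nb by blast
    have "a \<noteq> b" "a \<noteq> c" "b \<noteq> c" using that adjD by auto
    have "p y \<in> tri r b c"
      using triangle_separates[of r b c a y] y that \<open>a \<noteq> b\<close> \<open>a \<noteq> c\<close> r w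
      by (auto simp: wheel_def dest: adjD)
    then have x3: "p x3 \<in> tri r b c" using both[of y r b c x3] y that r(4,5) by auto
    \<comment> \<open>The inner vertex \<open>a\<close> splits the triangle \<open>r b c\<close>
      into three pieces, one of which holds \<open>x3\<close>.\<close>
    have "tri r b c = (\<Union>s\<in>{p r, p b, p c}. convex hull insert (p a) ({p r, p b, p c} - {s}))"
      by (rule convex_hull_exchange_Union) fact
    moreover have "insert (p a) ({p r, p b, p c} - {p r}) \<subseteq> {p a, p b, p c}"
      "insert (p a) ({p r, p b, p c} - {p b}) \<subseteq> {p r, p a, p c}"
      "insert (p a) ({p r, p b, p c} - {p c}) \<subseteq> {p r, p a, p b}" by auto
    note this[THEN hull_mono, of convex]
    ultimately have "p x3 \<in> tri a b c \<or> p x3 \<in> tri r a c \<or> p x3 \<in> tri r a b"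
      using x3 by blast
    \<comment> \<open>In a piece with corner \<open>r\<close>, the omitted corner \<open>b'\<close>
      is drawn in through its neighbour among \<open>x3\<close>, \<open>x4\<close>; the piece and
      the whole triangle then enclose each other.\<close>
    moreover have False if "p x3 \<in> tri r a c'" "{b', c'} = {b, c}" for b' c'
    proof -
      have *: "adj b' c'" "adj a c'" "adj a b'" "adj r b'" "adj r c'" "adj b' x3 \<or> adj b' x4" "tri r b c = tri r b' c'"
        using that(2) \<open>adj b c\<close> \<open>adj a b\<close> \<open>adj a c\<close> \<open>adj r b\<close> \<open>adj r c\<close> nb
        by (auto simp: doubleton_eq_iff adj_commute insert_commute)
      have ne: "b' \<noteq> x3" "b' \<noteq> x4" "c' \<noteq> x3" "c' \<noteq> x4" "b' \<noteq> c'" "b' \<noteq> a" "b' \<noteq> r"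
        using that(2) sets \<open>b \<noteq> c\<close> \<open>a \<noteq> b\<close> \<open>a \<noteq> c\<close> by (auto simp: doubleton_eq_iff)
      have "p b' \<in> tri r a c'"
        using follow[of r a c' b'] that(1) * ne \<open>adj r a\<close> r(4,5) sets by auto
      then have "a \<in> {r, b', c'}"
        using mutually_inscribed_triangles[of r a c' r b' c'] * \<open>p a \<in> tri r b c\<close> \<open>adj r a\<close>
        by (auto dest: adjD intro: hull_inc)
      then show False using * ne sets by (auto dest: adjD)
    qed
    ultimately show ?thesis by blast
  qed
  have A: "adj q x1" "adj x1 x2" "adj q x2" "adj q x3" "adj q x4" "adj x2 x3" "adj x4 x1"
    and D: "distinct [q, x1, x2, x3, x4]"
    using w by (simp_all add: wheel_def)
  \<comment> \<open>One of the four vertices lies in the triangle of the others, and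
    \<open>out\<close> excludes \<open>r\<close>.\<close>
  from four_clique_nested[OF A(1-3) r(1-3)] out
  consider "p q \<in> tri r x1 x2" | "p x1 \<in> tri r q x2" | "p x2 \<in> tri r q x1"
    by (auto simp: insert_commute)
  then have "p x3 \<in> tri q x1 x2 \<or> p x4 \<in> tri q x1 x2"
  proof cases
    case 1
    show ?thesis using key[OF 1] A D r by (auto simp: adj_commute dest: adjD)
  next
    case 2
    show ?thesis using key[OF 2] A D r by (auto simp: adj_commute insert_commute dest: adjD)
  next
    case 3
    show ?thesis using key[OF 3] A D r by (auto simp: adj_commute insert_commute dest: adjD)
  qed
  then show ?thesis using rim_in_triangle w by blast
qed

text \<open>Otherwise \<open>r\<close> lies in both triangles \<open>q x1 x2\<close> and
  \<open>q y1 y2\<close> and draws the base of each into the other.\<close>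

lemma rim_containment_dichotomy:
  assumes w: "wheel q x1 x2 x3 x4" "wheel q y1 y2 y3 y4"
    and disj: "{x1, x2, x3, x4} \<inter> {y1, y2, y3, y4} = {}"
    and r: "adj r q" "adj r x1" "adj r x2" "adj r y1" "adj r y2" "r \<notin> {x3, x4, y3, y4}"
  shows "contains_rim q x1 x2 x3 x4 \<or> contains_rim q y1 y2 y3 y4"
proof (rule ccontr)
  assume "\<not> ?thesis"
  then have rin: "p r \<in> tri q x1 x2" "p r \<in> tri q y1 y2"
    using contains_rim_or_in_triangle[OF w(1), of r] contains_rim_or_in_triangle[OF w(2), of r] r by auto
  have A: "adj q x1" "adj x1 x2" "adj q x2" "adj q y1" "adj y1 y2" "adj q y2"
    and D: "distinct [q, x1, x2, x3, x4]" "distinct [q, y1, y2, y3, y4]"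
    using w by (simp_all add: wheel_def)
  have nr: "r \<notin> {q, x1, x2, y1, y2}" using r adjD by auto
  have "p y1 \<in> tri q x1 x2" "p y2 \<in> tri q x1 x2" "p x1 \<in> tri q y1 y2" "p x2 \<in> tri q y1 y2"
    using triangle_separates[of q x1 x2 r] triangle_separates[of q y1 y2 r] A D disj rin r nr by auto
  then have "x1 \<in> {q, y1, y2}"
    using mutually_inscribed_triangles[of q x1 x2 q y1 y2] A by (auto dest: adjD intro: hull_inc)
  then show False using D disj by auto
qed

text \<open>The second apex is a bare point \<open>y\<close> because it is the hub of another frame.
  The two containments make the rim edges \<open>x2 x3\<close> and \<open>x4 x1\<close>
  cross.\<close>

lemma contains_rim_not_opposite:
  assumes w: "wheel q x1 x2 x3 x4" and c: "contains_rim q x1 x2 x3 x4"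
    and opp: "p x1 \<in> convex hull {y, p x3, p x4}" "p x2 \<in> convex hull {y, p x3, p x4}"
    and y: "orient (p x3) (p x4) y \<noteq> 0"
  shows False
proof -
  have A: "adj x1 x2" "adj x2 x3" "adj x3 x4" "adj x4 x1" "adj x2 q" "adj x1 q"
    and D: "distinct [q, x1, x2, x3, x4]"
    using w by (auto simp: wheel_def adj_commute)
  have "p x3 \<notin> closed_segment (p x1) (p x2)" "p x4 \<notin> closed_segment (p x1) (p x2)"
    "p x1 \<notin> closed_segment (p x3) (p x4)" "p x2 \<notin> closed_segment (p x3) (p x4)"
    by (rule vertex_notin_edge; use A D adjD(2) in auto)+
  moreover have "orient (p x1) (p x2) (p q) \<noteq> 0"
    using triangle_orient A by blast
  ultimately have "orient (p x1) (p x2) (p x3) \<noteq> 0" "orient (p x1) (p x2) (p x4) \<noteq> 0"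
    "orient (p x3) (p x4) (p x1) \<noteq> 0" "orient (p x3) (p x4) (p x2) \<noteq> 0"
    using c opp y orient_base_nonzero unfolding contains_rim_def by blast+
  then have "closed_segment (p x2) (p x3) \<inter> closed_segment (p x4) (p x1) \<noteq> {}"
    using c opp opposite_apexes_cross unfolding contains_rim_def by blast
  then show False using edges_disjoint[of x2 x3 x4 x1] A D by auto
qed

end

section \<open>Storyplans of the graph\<close>

text \<open>Helly's theorem on the line, with the latest start as the common point.\<close>

lemma intervals_common_point:
  fixes s e :: "'v \<Rightarrow> nat"
  assumes "finite W" "W \<noteq> {}" "\<And>u v. u \<in> W \<Longrightarrow> v \<in> W \<Longrightarrow> s u \<le> e v"
  shows "\<exists>t. \<forall>w\<in>W. s w \<le> t \<and> t \<le> e w"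
  using assms by (intro exI[of _ "Max (s ` W)"]) auto

section \<open>Indices and edges of the graph\<close>

lemma nxt_mem: "i \<in> {1..4} \<Longrightarrow> nxt i \<in> {1..4}"
  by (auto simp: nxt_def)

lemma in_1_4_cases: "i \<in> {1..4} \<Longrightarrow> i = 1 \<or> i = 2 \<or> i = 3 \<or> i = (4 :: nat)"
  by auto

lemma nxt_four: "i \<in> {1..4} \<Longrightarrow> nxt (nxt (nxt (nxt i))) = i"
  by (drule in_1_4_cases) (auto simp: nxt_def)

lemma nxt_distinct: "i \<in> {1..4} \<Longrightarrow> distinct [i, nxt i, nxt (nxt i), nxt (nxt (nxt i))]"
  by (drule in_1_4_cases) (auto simp: nxt_def)

text \<open>Constructors are taken as functions of the index, so that one statement covers all three
  four-cycles.\<close>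

definition cycles :: "(nat \<Rightarrow> gv) set" where
  "cycles = {A, B, C}"

definition cycle_vertices :: "gv set" where
  "cycle_vertices = (\<Union>f\<in>cycles. f ` {1..4})"

definition hubs :: "gv set" where
  "hubs = (\<lambda>(i, j). Q i j) ` ({1..4} \<times> {1..2})"

text \<open>The thirteen edge families are separated once, so that later membership goals concern a
  single comprehension.\<close>

lemma G_E_parts:
  "{{A i, A (nxt i)} | i. i \<in> {1..4}} \<subseteq> G_E"
  "{{B i, B (nxt i)} | i. i \<in> {1..4}} \<subseteq> G_E"
  "{{C i, C (nxt i)} | i. i \<in> {1..4}} \<subseteq> G_E"
  "{{Q i j, A k} | i j k. i \<in> {1..4} \<and> j \<in> {1..2} \<and> k \<in> {1..4}} \<subseteq> G_E"
  "{{Q i j, B k} | i j k. i \<in> {1..4} \<and> j \<in> {1..2} \<and> k \<in> {1..4}} \<subseteq> G_E"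
  "{{Q i j, C k} | i j k. i \<in> {1..4} \<and> j \<in> {1..2} \<and> k \<in> {1..4}} \<subseteq> G_E"
  "{{R i j, Q i j} | i j. i \<in> {1..4} \<and> j \<in> {1..2}} \<subseteq> G_E"
  "{{R i j, A i} | i j. i \<in> {1..4} \<and> j \<in> {1..2}} \<subseteq> G_E"
  "{{R i j, A (nxt i)} | i j. i \<in> {1..4} \<and> j \<in> {1..2}} \<subseteq> G_E"
  "{{R i j, B i} | i j. i \<in> {1..4} \<and> j \<in> {1..2}} \<subseteq> G_E"
  "{{R i j, B (nxt i)} | i j. i \<in> {1..4} \<and> j \<in> {1..2}} \<subseteq> G_E"
  "{{R i j, C i} | i j. i \<in> {1..4} \<and> j \<in> {1..2}} \<subseteq> G_E"
  "{{R i j, C (nxt i)} | i j. i \<in> {1..4} \<and> j \<in> {1..2}} \<subseteq> G_E"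
  unfolding G_E_def by (rule subsetI, simp only: Un_iff simp_thms)+

lemma cycle_edge:
  assumes "f \<in> cycles" "i \<in> {1..4}"
  shows "{f i, f (nxt i)} \<in> G_E"
proof -
  from assms(1) consider "f = A" | "f = B" | "f = C" by (auto simp: cycles_def)
  then show ?thesis
  proof cases
    case 1 show ?thesis unfolding 1 by (rule G_E_parts(1)[THEN subsetD]) (use assms in blast)
  next
    case 2 show ?thesis unfolding 2 by (rule G_E_parts(2)[THEN subsetD]) (use assms in blast)
  next
    case 3 show ?thesis unfolding 3 by (rule G_E_parts(3)[THEN subsetD]) (use assms in blast)
  qed
qed

lemma hub_edge:
  assumes "f \<in> cycles" "k \<in> {1..4}" "i \<in> {1..4}" "j \<in> {1..2}"
  shows "{Q i j, f k} \<in> G_E"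
proof -
  from assms(1) consider "f = A" | "f = B" | "f = C" by (auto simp: cycles_def)
  then show ?thesis
  proof cases
    case 1 show ?thesis unfolding 1 by (rule G_E_parts(4)[THEN subsetD]) (use assms in blast)
  next
    case 2 show ?thesis unfolding 2 by (rule G_E_parts(5)[THEN subsetD]) (use assms in blast)
  next
    case 3 show ?thesis unfolding 3 by (rule G_E_parts(6)[THEN subsetD]) (use assms in blast)
  qed
qed

lemma R_edge_hub: "i \<in> {1..4} \<Longrightarrow> j \<in> {1..2} \<Longrightarrow> {R i j, Q i j} \<in> G_E"
  by (rule G_E_parts(7)[THEN subsetD]) blast

lemma R_edge_cycle:
  assumes "f \<in> cycles" "i \<in> {1..4}" "j \<in> {1..2}"
  shows "{R i j, f i} \<in> G_E" "{R i j, f (nxt i)} \<in> G_E"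
proof -
  from assms(1) consider "f = A" | "f = B" | "f = C" by (auto simp: cycles_def)
  then have "{R i j, f i} \<in> G_E \<and> {R i j, f (nxt i)} \<in> G_E"
  proof cases
    case 1 show ?thesis unfolding 1
      by (rule conjI, rule G_E_parts(8)[THEN subsetD], use assms in blast,
          rule G_E_parts(9)[THEN subsetD], use assms in blast)
  next
    case 2 show ?thesis unfolding 2
      by (rule conjI, rule G_E_parts(10)[THEN subsetD], use assms in blast,
          rule G_E_parts(11)[THEN subsetD], use assms in blast)
  next
    case 3 show ?thesis unfolding 3
      by (rule conjI, rule G_E_parts(12)[THEN subsetD], use assms in blast,
          rule G_E_parts(13)[THEN subsetD], use assms in blast)
  qed
  then show "{R i j, f i} \<in> G_E" "{R i j, f (nxt i)} \<in> G_E" by blast+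
qed

lemma cycles_inj: "f \<in> cycles \<Longrightarrow> f i = f j \<longleftrightarrow> i = j"
  by (auto simp: cycles_def)

lemma cycles_neq: "f \<in> cycles \<Longrightarrow> g \<in> cycles \<Longrightarrow> f \<noteq> g \<Longrightarrow> f i \<noteq> g j"
  by (auto simp: cycles_def)

lemma cycles_not_QR [simp]:
  "f \<in> cycles \<Longrightarrow> f k \<noteq> Q i j" "f \<in> cycles \<Longrightarrow> Q i j \<noteq> f k"
  "f \<in> cycles \<Longrightarrow> f k \<noteq> R i j" "f \<in> cycles \<Longrightarrow> R i j \<noteq> f k"
  by (auto simp: cycles_def)

lemma cycle_vertex_in_G_V: "f \<in> cycles \<Longrightarrow> i \<in> {1..4} \<Longrightarrow> f i \<in> G_V"
  unfolding cycles_def G_V_def by auto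

lemma QR_in_G_V: "i \<in> {1..4} \<Longrightarrow> j \<in> {1..2} \<Longrightarrow> Q i j \<in> G_V \<and> R i j \<in> G_V"
  unfolding G_V_def by auto

lemma cycle_verticesI: "f \<in> cycles \<Longrightarrow> i \<in> {1..4} \<Longrightarrow> f i \<in> cycle_vertices"
  unfolding cycle_vertices_def by blast

lemma cycle_vertices_sub: "cycle_vertices \<subseteq> G_V"
  unfolding cycle_vertices_def using cycle_vertex_in_G_V by auto

lemma finite_cycle_vertices: "finite cycle_vertices"
  by (simp add: cycle_vertices_def cycles_def)

section \<open>Overlapping intervals and common frames\<close>

locale G_storyplan =
  fixes l :: nat and s e :: "gv \<Rightarrow> nat" and p :: "gv \<Rightarrow> real \<times> real"
  assumes plan: "planar_geometric_storyplan G_V G_E l s e p"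
begin

lemma interval: "v \<in> G_V \<Longrightarrow> 1 \<le> s v \<and> s v \<le> e v \<and> e v \<le> l"
  using plan by (simp add: planar_geometric_storyplan_def storyplan_intervals_def)

lemma edge_meets:
  assumes "{u, v} \<in> G_E" "u \<in> G_V" "v \<in> G_V"
  shows "s u \<le> e v" "s v \<le> e u"
proof -
  have "{s u..e u} \<inter> {s v..e v} \<noteq> {}"
    using assms plan by (simp add: planar_geometric_storyplan_def storyplan_intervals_def)
  then show "s u \<le> e v" "s v \<le> e u" by auto
qed

lemma common_frame:
  assumes "finite W" "W \<noteq> {}" "W \<subseteq> G_V" "\<And>u v. u \<in> W \<Longrightarrow> v \<in> W \<Longrightarrow> s u \<le> e v"
  obtains S where "frame_drawing G_E p S" "W \<subseteq> S"
proof -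
  obtain t where t: "\<forall>w\<in>W. s w \<le> t \<and> t \<le> e w"
    using intervals_common_point[of W s e] assms by blast
  then have "t \<in> {1..l}" using assms(2,3) interval by fastforce
  then have "planar_straight_line_drawing G_V G_E p (visible_at G_V s e t)"
    using plan by (simp add: planar_geometric_storyplan_def)
  then have "frame_drawing G_E p (visible_at G_V s e t)"
    by (simp add: frame_drawing_def planar_straight_line_drawing_def)
  moreover have "W \<subseteq> visible_at G_V s e t"
    using t assms(3) by (auto simp: visible_at_def)
  ultimately show thesis by (rule that)
qed

lemma hub_meets:
  assumes "q \<in> hubs" "x \<in> cycle_vertices"
  shows "s q \<le> e x" "s x \<le> e q"
  using assms edge_meets[OF hub_edge] QR_in_G_V cycle_vertex_in_G_V
  by (auto simp: hubs_def cycle_vertices_def)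

text \<open>If the intervals of \<open>A 1\<close> and \<open>A 3\<close> are disjoint, those of
  \<open>A 2\<close> and \<open>A 4\<close> both cover the gap between them and so meet.\<close>

lemma cycle_chord:
  obtains k where "k \<in> {1, 2}" "s (A k) \<le> e (A (k + 2))" "s (A (k + 2)) \<le> e (A k)"
proof -
  have A: "A \<in> cycles" by (simp add: cycles_def)
  have step: "s (A i) \<le> e (A (nxt i))" "s (A (nxt i)) \<le> e (A i)" if "i \<in> {1..4}" for i
    using edge_meets[OF cycle_edge[OF A that]] cycle_vertex_in_G_V[OF A] that nxt_mem by blast+
  have n: "nxt 1 = 2" "nxt 2 = 3" "nxt 3 = 4" "nxt 4 = 1" by (simp_all add: nxt_def)
  have m: "1 \<in> {1..4::nat}" "2 \<in> {1..4::nat}" "3 \<in> {1..4::nat}" "4 \<in> {1..4::nat}" by simp_all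
  have "s (A 1) \<le> e (A 3) \<and> s (A 3) \<le> e (A 1) \<or> s (A 2) \<le> e (A 4) \<and> s (A 4) \<le> e (A 2)"
    using step[OF m(1)] step[OF m(2)] step[OF m(3)] step[OF m(4)] unfolding n by linarith
  moreover have "(1::nat) + 2 = 3" "(2::nat) + 2 = 4" by simp_all
  ultimately show thesis using that[of 1] that[of 2] by (metis insertI1 insert_commute)
qed

text \<open>If \<open>x\<close> started after the end of \<open>y\<close>, every hub would span the
  gap, as it meets both; all eight hubs would then meet pairwise.\<close>

lemma cycle_vertices_meet:
  assumes "x \<in> cycle_vertices" "y \<in> cycle_vertices"
  shows "s x \<le> e y"
proof (rule ccontr)
  assume "\<not> s x \<le> e y"
  then have hub2: "s q \<le> e q'" if "q \<in> hubs" "q' \<in> hubs" for q q'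
    using hub_meets that assms by (meson le_trans nat_le_linear)
  obtain k where k: "k \<in> {1, 2}" "s (A k) \<le> e (A (k + 2))" "s (A (k + 2)) \<le> e (A k)"
    by (rule cycle_chord)
  have A: "A \<in> cycles" by (simp add: cycles_def)
  have nk: "nxt k = k + 1" "nxt (k + 1) = k + 2" and rg: "k \<in> {1..4}" "k + 1 \<in> {1..4}" "k + 2 \<in> {1..4}"
    using k(1) by (auto simp: nxt_def)
  have V: "A i \<in> G_V" "A i \<in> cycle_vertices" if "i \<in> {1..4}" for i
    using cycle_vertex_in_G_V cycle_verticesI A that by blast+
  have ed: "{A k, A (k + 1)} \<in> G_E" "{A (k + 1), A (k + 2)} \<in> G_E"
    using cycle_edge[OF A rg(1)] cycle_edge[OF A rg(2)] nk by auto
  \<comment> \<open>The chord makes these three intervals meet pairwise; the first two vertices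
    supply the drawn edge, the third the extra common neighbour.\<close>
  define T where "T = {A k, A (k + 1), A (k + 2)}"
  have TT: "s u \<le> e v" if "u \<in> T" "v \<in> T" for u v
    using that edge_meets[OF ed(1)] edge_meets[OF ed(2)] V rg k interval unfolding T_def by blast
  have TV: "T \<subseteq> cycle_vertices" "T \<subseteq> G_V" using V rg by (auto simp: T_def)
  have "finite (T \<union> hubs)" "T \<union> hubs \<noteq> {}" "T \<union> hubs \<subseteq> G_V"
    using TV QR_in_G_V by (auto simp: T_def hubs_def)
  moreover have "s u \<le> e v" if "u \<in> T \<union> hubs" "v \<in> T \<union> hubs" for u v
    using that TT hub2 hub_meets TV(1) by blast
  ultimately obtain S where S: "frame_drawing G_E p S" "T \<union> hubs \<subseteq> S"
    by (rule common_frame)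
  interpret frame_drawing G_E p S by fact
  show False
  proof (rule no_three_by_five)
    show "adj (A k) (A (k + 1))" using S(2) ed by (auto simp: adj_def T_def)
    show "A (k + 2) \<noteq> A k" "A (k + 2) \<noteq> A (k + 1)" by auto
    show "finite hubs" by (simp add: hubs_def)
    have "card hubs = card ({1..4::nat} \<times> {1..2::nat})"
      unfolding hubs_def by (rule card_image) (auto simp: inj_on_def)
    then show "5 \<le> card hubs" by simp
    fix q assume q: "q \<in> hubs"
    then have "adj q (A i)" if "i \<in> {1..4}" "A i \<in> T" for i
      using that S(2) hub_edge[OF A] by (auto simp: adj_def hubs_def)
    then show "adj q (A k) \<and> adj q (A (k + 1)) \<and> adj q (A (k + 2))"
      using rg by (simp add: T_def)
  qed
qed

lemma cycle_wheel:
  assumes "frame_drawing G_E p S" "cycle_vertices \<subseteq> S" "Q i j \<in> S"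
    and "f \<in> cycles" "i \<in> {1..4}" "j \<in> {1..2}" "k \<in> {1..4}"
  shows "frame_drawing.wheel G_E S (Q i j) (f k) (f (nxt k)) (f (nxt (nxt k))) (f (nxt (nxt (nxt k))))"
proof -
  interpret frame_drawing G_E p S by fact
  have n: "nxt k \<in> {1..4}" "nxt (nxt k) \<in> {1..4}" "nxt (nxt (nxt k)) \<in> {1..4}"
    using assms nxt_mem by blast+
  have inS: "f i \<in> S" if "i \<in> {1..4}" for i
    using that assms cycle_verticesI by blast
  have spoke: "adj (Q i j) (f i')" if "i' \<in> {1..4}" for i'
    using that assms inS hub_edge by (simp add: adj_def)
  have rim: "adj (f i') (f (nxt i'))" if "i' \<in> {1..4}" for i'
    using that assms inS cycle_edge nxt_mem nxt_distinct[OF that] by (simp add: adj_def cycles_inj)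
  show ?thesis
    using nxt_distinct[OF assms(7)] nxt_four[OF assms(7)] assms(4) spoke[OF assms(7)]
      spoke[OF n(1)] spoke[OF n(2)] spoke[OF n(3)] rim[OF assms(7)] rim[OF n(1)] rim[OF n(2)] rim[OF n(3)]
    unfolding wheel_def by (simp add: cycles_inj)
qed

text \<open>Meeting hubs share a frame with all twelve cycle vertices, where two distinct hubs are
  impossible.\<close>

lemma hubs_disjoint:
  assumes "i \<in> {1..4}" "j \<in> {1..2}" "i' \<in> {1..4}" "j' \<in> {1..2}"
    and "s (Q i j) \<le> e (Q i' j')" "s (Q i' j') \<le> e (Q i j)"
  shows "i = i' \<and> j = j'"
proof -
  define W where "W = cycle_vertices \<union> {Q i j, Q i' j'}"
  have h: "Q i j \<in> hubs" "Q i' j' \<in> hubs" using assms by (auto simp: hubs_def)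
  have "finite W" "W \<noteq> {}" "W \<subseteq> G_V"
    using cycle_vertices_sub finite_cycle_vertices QR_in_G_V assms by (auto simp: W_def)
  moreover have "s u \<le> e v" if "u \<in> W" "v \<in> W" for u v
    using that cycle_vertices_meet hub_meets h assms interval QR_in_G_V unfolding W_def by blast
  ultimately obtain S where S: "frame_drawing G_E p S" "W \<subseteq> S"
    by (rule common_frame)
  interpret frame_drawing G_E p S by fact
  have 1: "(1::nat) \<in> {1..4}" by simp
  have sub: "cycle_vertices \<subseteq> S" "Q i j \<in> S" "Q i' j' \<in> S" using S(2) by (auto simp: W_def)
  have cyc: "A \<in> cycles" "B \<in> cycles" "C \<in> cycles" by (auto simp: cycles_def)
  note w = cycle_wheel[OF S(1) sub(1) sub(2) _ assms(1,2) 1] cycle_wheel[OF S(1) sub(1) sub(3) _ assms(3,4) 1]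
  have "Q i j = Q i' j'"
    by (rule no_two_common_hubs[OF w(1)[OF cyc(1)] w(1)[OF cyc(2)] w(1)[OF cyc(3)]
          w(2)[OF cyc(1)] w(2)[OF cyc(2)] w(2)[OF cyc(3)]]) auto
  then show ?thesis by simp
qed

section \<open>Frames with a vertex \<open>R i j\<close>\<close>

text \<open>With the overlaps already known, this puts \<open>R i j\<close>, its hub and all cycle
  vertices into one frame.\<close>

definition good :: "nat \<Rightarrow> nat \<Rightarrow> bool" where
  "good i j \<longleftrightarrow> (\<forall>x\<in>cycle_vertices. s (R i j) \<le> e x \<and> s x \<le> e (R i j))"

text \<open>Depends on the positions \<open>p\<close> alone, so facts from different frames can be
  combined; \<open>k\<close> selects the rim edge carrying the triangle.\<close>

definition surrounds :: "nat \<Rightarrow> nat \<Rightarrow> (nat \<Rightarrow> gv) \<Rightarrow> nat \<Rightarrow> bool" where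
  "surrounds i j f k \<longleftrightarrow>
     frame_drawing.contains_rim p (Q i j) (f k) (f (nxt k)) (f (nxt (nxt k))) (f (nxt (nxt (nxt k))))"

text \<open>\<open>R i j\<close> is adjacent to its hub and to both ends of the \<open>i\<close>-th
  edge of each cycle, as the dichotomy for two rims requires. Hence at most one cycle is not
  surrounded.\<close>

lemma good_frame:
  assumes ij: "i \<in> {1..4}" "j \<in> {1..2}" and "good i j"
  obtains S where "frame_drawing G_E p S" "cycle_vertices \<subseteq> S" "Q i j \<in> S"
    "\<And>f g. f \<in> cycles \<Longrightarrow> g \<in> cycles \<Longrightarrow> f \<noteq> g \<Longrightarrow> surrounds i j f i \<or> surrounds i j g i"
proof -
  define W where "W = cycle_vertices \<union> {Q i j, R i j}"
  have h: "Q i j \<in> hubs" using assms by (auto simp: hubs_def)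
  have "finite W" "W \<noteq> {}" "W \<subseteq> G_V"
    using cycle_vertices_sub finite_cycle_vertices QR_in_G_V assms by (auto simp: W_def)
  moreover have "s u \<le> e v" if "u \<in> W" "v \<in> W" for u v
    using that cycle_vertices_meet hub_meets h assms(3) interval QR_in_G_V[OF ij]
      edge_meets[OF R_edge_hub[OF ij]] unfolding W_def good_def by blast
  ultimately obtain S where S: "frame_drawing G_E p S" "W \<subseteq> S"
    by (rule common_frame)
  interpret frame_drawing G_E p S by fact
  have sub: "cycle_vertices \<subseteq> S" "Q i j \<in> S" "R i j \<in> S" using S(2) by (auto simp: W_def)
  have adjR: "adj (R i j) (f i)" "adj (R i j) (f (nxt i))" if "f \<in> cycles" for f
    using that sub R_edge_cycle[OF that ij] cycle_verticesI[OF that] ij(1) nxt_mem[OF ij(1)]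
    by (auto simp: adj_def)
  have adjQ: "adj (R i j) (Q i j)"
    using sub R_edge_hub[OF ij] by (auto simp: adj_def)
  have "surrounds i j f i \<or> surrounds i j g i" if "f \<in> cycles" "g \<in> cycles" "f \<noteq> g" for f g
    unfolding surrounds_def
  proof (rule rim_containment_dichotomy)
    show "wheel (Q i j) (f i) (f (nxt i)) (f (nxt (nxt i))) (f (nxt (nxt (nxt i))))"
      "wheel (Q i j) (g i) (g (nxt i)) (g (nxt (nxt i))) (g (nxt (nxt (nxt i))))"
      using cycle_wheel[OF S(1) sub(1,2) _ ij ij(1)] that by blast+
  qed (use adjR adjQ that cycles_neq in auto)
  then show thesis using that S(1) sub by blast
qed

lemma not_good_opposite:
  assumes i: "i \<in> {1..4}" and j: "j \<in> {1..2}" "j' \<in> {1..2}"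
    and "good i j" "good (nxt (nxt i)) j'"
  shows False
proof -
  define i' where "i' = nxt (nxt i)"
  have i': "i' \<in> {1..4}" using i nxt_mem by (simp add: i'_def)
  obtain S where S: "frame_drawing G_E p S" "cycle_vertices \<subseteq> S" "Q i j \<in> S"
    "\<And>f g. f \<in> cycles \<Longrightarrow> g \<in> cycles \<Longrightarrow> f \<noteq> g \<Longrightarrow> surrounds i j f i \<or> surrounds i j g i"
    using good_frame[OF i j(1) assms(4)] by blast
  obtain S' where S': "frame_drawing G_E p S'" "cycle_vertices \<subseteq> S'" "Q i' j' \<in> S'"
    "\<And>f g. f \<in> cycles \<Longrightarrow> g \<in> cycles \<Longrightarrow> f \<noteq> g \<Longrightarrow> surrounds i' j' f i' \<or> surrounds i' j' g i'"
    using good_frame[OF i' j(2)] assms(5) unfolding i'_def by blast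
  have "A \<in> cycles" "B \<in> cycles" "C \<in> cycles" "A \<noteq> B" "A \<noteq> C" "B \<noteq> C"
    by (auto simp: cycles_def fun_eq_iff)
  \<comment> \<open>Each frame misses at most one of the three cycles, so one cycle is surrounded in
    both.\<close>
  then obtain f where f: "f \<in> cycles" "surrounds i j f i" "surrounds i' j' f i'"
    using S(4) S'(4) by metis
  interpret F: frame_drawing G_E p S by fact
  interpret F': frame_drawing G_E p S' by fact
  have w: "F.wheel (Q i j) (f i) (f (nxt i)) (f i') (f (nxt i'))"
    using cycle_wheel[OF S(1-3) f(1) i j(1) i] by (simp add: i'_def)
  have w': "F'.wheel (Q i' j') (f i') (f (nxt i')) (f i) (f (nxt i))"
    using cycle_wheel[OF S'(1-3) f(1) i' j(2) i'] nxt_four[OF i] by (simp add: i'_def)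
  have c: "F.contains_rim (Q i j) (f i) (f (nxt i)) (f i') (f (nxt i'))"
    using f(2) by (simp add: surrounds_def i'_def)
  have c': "F'.contains_rim (Q i' j') (f i') (f (nxt i')) (f i) (f (nxt i))"
    using f(3) nxt_four[OF i] by (simp add: surrounds_def i'_def)
  have "orient (p (f i')) (p (f (nxt i'))) (p (Q i' j')) \<noteq> 0"
    using w' F'.triangle_orient F'.adj_commute unfolding F'.wheel_def by blast
  then show False
    using F.contains_rim_not_opposite[OF w c] c' unfolding F'.contains_rim_def by blast
qed

section \<open>Counting the bad vertices\<close>

text \<open>Such a hub has started before some cycle vertex starts, and every hub lasts until each
  cycle vertex has started; so the two hubs meet and are equal.\<close>

lemma bad_before_unique:
  assumes "i \<in> {1..4}" "j \<in> {1..2}" "i' \<in> {1..4}" "j' \<in> {1..2}"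
    and "x \<in> cycle_vertices" "e (R i j) < s x" "x' \<in> cycle_vertices" "e (R i' j') < s x'"
  shows "i = i' \<and> j = j'"
proof (rule hubs_disjoint)
  have h: "Q i j \<in> hubs" "Q i' j' \<in> hubs" using assms by (auto simp: hubs_def)
  have "s (Q i j) \<le> e (R i j)" "s (Q i' j') \<le> e (R i' j')"
    using edge_meets[OF R_edge_hub[OF assms(1,2)]] edge_meets[OF R_edge_hub[OF assms(3,4)]]
      QR_in_G_V[OF assms(1,2)] QR_in_G_V[OF assms(3,4)] by auto
  then show "s (Q i j) \<le> e (Q i' j')" "s (Q i' j') \<le> e (Q i j)"
    using hub_meets(2)[OF h(1) assms(5)] hub_meets(2)[OF h(2) assms(5)]
      hub_meets(2)[OF h(1) assms(7)] hub_meets(2)[OF h(2) assms(7)] assms(6,8) by linarith+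
qed (use assms in auto)

text \<open>The time reversal of the preceding argument.\<close>

lemma bad_after_unique:
  assumes "i \<in> {1..4}" "j \<in> {1..2}" "i' \<in> {1..4}" "j' \<in> {1..2}"
    and "x \<in> cycle_vertices" "e x < s (R i j)" "x' \<in> cycle_vertices" "e x' < s (R i' j')"
  shows "i = i' \<and> j = j'"
proof (rule hubs_disjoint)
  have h: "Q i j \<in> hubs" "Q i' j' \<in> hubs" using assms by (auto simp: hubs_def)
  have "s (R i j) \<le> e (Q i j)" "s (R i' j') \<le> e (Q i' j')"
    using edge_meets[OF R_edge_hub[OF assms(1,2)]] edge_meets[OF R_edge_hub[OF assms(3,4)]]
      QR_in_G_V[OF assms(1,2)] QR_in_G_V[OF assms(3,4)] by auto
  then show "s (Q i j) \<le> e (Q i' j')" "s (Q i' j') \<le> e (Q i j)"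
    using hub_meets(1)[OF h(1) assms(5)] hub_meets(1)[OF h(2) assms(5)]
      hub_meets(1)[OF h(1) assms(7)] hub_meets(1)[OF h(2) assms(7)] assms(6,8) by linarith+
qed (use assms in auto)

text \<open>Each bad \<open>R i j\<close> is bad before or after, so at most two are bad in all. Without an opposite
  good pair there would be four.\<close>

lemma inconsistent: False
proof -
  define before where "before i j \<longleftrightarrow> (\<exists>x\<in>cycle_vertices. e (R i j) < s x)" for i j
  define after where "after i j \<longleftrightarrow> (\<exists>x\<in>cycle_vertices. e x < s (R i j))" for i j
  have bad: "before i j \<or> after i j" if "\<not> good i j" for i j
    using that by (auto simp: good_def before_def after_def not_le)
  have u: "i = i' \<and> j = j'" if "before i j \<and> before i' j' \<or> after i j \<and> after i' j'"
    "i \<in> {1..4}" "j \<in> {1..2}" "i' \<in> {1..4}" "j' \<in> {1..2}" for i j i' j'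
    using that bad_before_unique bad_after_unique unfolding before_def after_def by blast
  have opp: "\<not> good i j \<or> \<not> good (i + 2) j'" if "i \<in> {1, 2}" "j \<in> {1..2}" "j' \<in> {1..2}" for i j j'
  proof -
    have "nxt (nxt i) = i + 2" "i \<in> {1..4}" using that(1) by (auto simp: nxt_def)
    then show ?thesis using not_good_opposite[of i j j'] that by metis
  qed
  \<comment> \<open>A good copy at one of the opposite indices \<open>a\<close>,
    \<open>a + 2\<close> makes both copies at the other bad.\<close>
  have "\<exists>i\<in>{a, a + 2}. \<not> good i 1 \<and> \<not> good i 2" if "a \<in> {1, 2}" for a
    using opp[of a 1 1] opp[of a 1 2] opp[of a 2 1] opp[of a 2 2] that by auto
  from this[of 1] this[of 2] obtain i i' where
    ii: "i \<in> {1, 1 + 2}" "\<not> good i 1" "\<not> good i 2"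
      "i' \<in> {2, 2 + 2}" "\<not> good i' 1" "\<not> good i' 2" by blast
  then have "i \<in> {1..4}" "i' \<in> {1..4}" "i \<noteq> i'" by auto
  \<comment> \<open>Three bad vertices already suffice: two of them are bad in the same way.\<close>
  then show False
    using ii bad[of i 1] bad[of i 2] bad[of i' 1] u[of i 1 i 2] u[of i 1 i' 1] u[of i 2 i' 1]
    by auto
qed

end

theorem theorem2:
  shows "\<not> admits_planar_geometric_storyplan G_V G_E"
proof
  assume "admits_planar_geometric_storyplan G_V G_E"
  then obtain l s e p where "planar_geometric_storyplan G_V G_E l s e p"
    unfolding admits_planar_geometric_storyplan_def by blast
  then interpret G_storyplan l s e p by unfold_locales
  show False by (rule inconsistent)
qed

end
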